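(* Let $b>0$ and $f\in PW_b^\star$. Then either $f\in PW_b^\infty$, or there is no separated sequence $X=\{x_k\}\subset\mathbb{R}$ with $D^-(X)>0$ such that $f(X)=\{f(x_k)\}\in l^\infty$.
   Context: The type of an entire function $f$ is $\mathrm{type}(f)=\inf\{\beta: \text{there is } C \text{ with } |f(z)|\le Ce^{\beta|z|}\text{ for all }z\in\mathbb{C}\}$ (with $\mathrm{type}(f)=\infty$ if no such $\beta$ exists or $f$ is not entire). For a locally integrable function $f$ on $\mathbb{R}$, $$\|f\|_{BMO}=\sup_I\frac{1}{|I|}\int_I\left|f(t)-\frac{1}{|I|}\int_If(s)\,ds\right|dt,$$ the supremum being over all bounded real intervals $I$; for entire $f$ this is applied to the restriction of $f$ to $\mathbb{R}$. Fixing a point $c$, the space $PW_b^\star$ is $$PW_b^\star=\{f:\ \mathrm{type}(f)\le\pi b,\ |f(c)|+\|f\|_{BMO}<\infty\}$$ (as a set it does not depend on $c$, since $f$ is entire). $PW_b^\infty$ is the space of $f\in L^\infty(\mathbb{R})$ whose (distributional) Fourier transform, with $\hat f(\omega)=\int f(t)e^{-2\pi i\omega t}dt$, is supported in $[-\frac b2,\frac b2]$; equivalently, the space of entire functions $f$ with $\mathrm{type}(f)\le\pi b$ whose restriction to $\mathbb{R}$ is in $L^\infty$. A sequence $X=\{x_k\}\subset\mathbb{R}$, indexed so that $x_k<x_{k+1}$, is separated if $\inf_k|x_{k+1}-x_k|>0$. Its lower uniform density is $$D^-(X)=\limsup_{r\to\infty}\ \inf_{a\in\mathbb{R}}\frac{N(X,[a,a+r))}{r},$$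 where $N(X,I)$ is the number of $x_k$ in the interval $I$. *)

theory Defs
  imports "HOL-Analysis.Analysis"
begin

definition exp_type :: "(complex \<Rightarrow> complex) \<Rightarrow> ereal" where
  "exp_type f =
     (if f holomorphic_on UNIV
      then (INF \<beta>\<in>{\<beta>::real. \<exists>C::real. \<forall>z. norm (f z) \<le> C * exp (\<beta> * norm z)}. ereal \<beta>)
      else \<infinity>)"

text \<open>
  Meaningful for locally integrable \<open>g\<close> only: the Bochner integral giving the mean
  value is \<open>0\<close> by convention when \<open>g\<close> is not integrable on \<open>I\<close>. Below it is applied to
  restrictions of entire functions.
\<close>

definition bmo_norm :: "(real \<Rightarrow> complex) \<Rightarrow> ennreal" where
  "bmo_norm g =
     (SUP I\<in>{I. is_interval I \<and> bounded I \<and> 0 < measure lborel I}.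
        (\<integral>\<^sup>+ t\<in>I. ennreal (norm (g t - (LBINT s:I. g s) /\<^sub>R measure lborel I)) \<partial>lborel)
          / emeasure lborel I)"

definition PW_star :: "complex \<Rightarrow> real \<Rightarrow> (complex \<Rightarrow> complex) set" where
  "PW_star c b =
     {f. exp_type f \<le> ereal (pi * b) \<and>
         ennreal (norm (f c)) + bmo_norm (\<lambda>t. f (of_real t)) < \<infinity>}"

definition in_Linfty :: "(real \<Rightarrow> complex) \<Rightarrow> bool" where
  "in_Linfty g \<longleftrightarrow>
     g \<in> borel_measurable lebesgue \<and> (\<exists>M::real. AE t in lebesgue. norm (g t) \<le> M)"

text \<open>
  The Paley-Wiener space of bounded functions, each identified with its entire extension.
\<close>

definition PW_infty :: "real \<Rightarrow> (complex \<Rightarrow> complex) set" where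
  "PW_infty b = {f. exp_type f \<le> ereal (pi * b) \<and> in_Linfty (\<lambda>t. f (of_real t))}"

text \<open>
  Sequences are indexed by the integers: a separated sequence that is bounded on one side
  has lower uniform density \<open>0\<close>, because the infimum below runs over all real \<open>a\<close>.
\<close>

definition separated_seq :: "(int \<Rightarrow> real) \<Rightarrow> bool" where
  "separated_seq x \<longleftrightarrow>
     (\<forall>k. x k < x (k + 1)) \<and> 0 < (INF k. \<bar>x (k + 1) - x k\<bar>)"

text \<open>Counting measure, unlike \<^const>\<open>card\<close>, gives \<open>\<infinity>\<close> on infinite sets.\<close>

definition num_points :: "(int \<Rightarrow> real) \<Rightarrow> real set \<Rightarrow> ennreal" where
  "num_points x I = emeasure (count_space UNIV) {k. x k \<in> I}"

definition lower_uniform_density :: "(int \<Rightarrow> real) \<Rightarrow> ennreal" where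
  "lower_uniform_density x =
     Limsup at_top (\<lambda>r::real. INF a::real. num_points x {a..<a + r} / ennreal r)"

end

theory Submission
  imports Defs "HOL-Complex_Analysis.Conformal_Mappings"
begin

text \<open>
  A function \<open>f\<close> of exponential type with finite \<open>BMO\<close> norm on the real line may be
  unbounded there, but its increments over steps of bounded length are not: for each \<open>r\<close> the
  quantity \<open>\<bar>f (x + h) - f x\<bar>\<close> stays bounded over all real \<open>x\<close> and \<open>0 \<le> h \<le> r\<close>
  (\<open>exponential_type_bmo_increments_bounded\<close>). A sequence of positive lower uniform density
  meets every interval of some fixed length \<open>r\<close>
  (\<open>positive_lower_uniform_density_imp_relatively_dense\<close>), so every real point is within
  \<open>r\<close> of a point of the sequence, and a bound for \<open>f\<close> on the sequence spreads to the whole line.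

  The increments are controlled as follows. Comparing \<open>f (x + h)\<close> and \<open>f x\<close> with the same mean
  value of \<open>f\<close> over an interval of length \<open>r + 1\<close> shows that \<open>g z = f (z + h) - f z\<close> has
  uniformly bounded \<open>L\<^sup>1\<close> norm over all real intervals of length \<open>1\<close>. That such a function
  of exponential type is bounded is the \<open>L\<^sup>1\<close>-local case of the Plancherel-Polya theorem,
  \<open>exponential_type_bounded_of_local_L1\<close>. It rests on duality: for a weight \<open>w\<close> with
  \<open>\<bar>w\<bar> \<le> 1\<close>, the average \<open>G z = \<integral> w t * g (z + t) dt\<close> over \<open>[0, 1]\<close> is again of
  exponential type and is bounded on the real line. The Phragmen-Lindelof principle bounds \<open>G\<close> on
  horizontal strips, and Cauchy's inequality then bounds \<open>G'\<close> on the real line. Since \<open>w\<close> is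
  arbitrary and the bound does not depend on it, \<open>g'\<close> also has bounded local \<open>L\<^sup>1\<close> norm.
  A function with \<open>g\<close> and \<open>g'\<close> both bounded in \<open>L\<^sup>1\<close> on unit intervals is bounded.
\<close>

section \<open>The Phragmen-Lindelof principle for exponential type\<close>

text \<open>
  Cubing the square root multiplies the argument by \<open>3/2\<close>, so it maps the quarter-plane sector
  \<open>\<bar>arg v\<bar> \<le> \<pi>/4\<close> into \<open>\<bar>arg\<bar> \<le> 3\<pi>/8\<close>, strictly inside the right half plane. Its real
  part therefore grows like \<open>\<bar>v\<bar>\<close> to the power \<open>3/2\<close>, which outweighs any linear exponent.
\<close>

lemma Re_csqrt_cube_lower_bound:
  assumes "\<bar>Im v\<bar> \<le> Re v"
  shows "norm v * sqrt (norm v) / 16 \<le> Re (csqrt v ^ 3)"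
proof -
  define p q where "p = Re (csqrt v)" and "q = Im (csqrt v)"
  have sq: "csqrt v ^ 2 = v" by (rule power2_csqrt)
  have p0: "p \<ge> 0"
    unfolding p_def using csqrt_principal[of v] by linarith
  have re: "Re v = p\<^sup>2 - q\<^sup>2" and im: "Im v = 2 * p * q"
    using arg_cong[OF sq, of Re] arg_cong[OF sq, of Im]
    by (auto simp: p_def q_def Re_power2 Im_power2 simp del: csqrt.sel power2_csqrt)
  have nrm: "norm v = p\<^sup>2 + q\<^sup>2"
    using arg_cong[OF sq, of norm] cmod_power2[of "csqrt v"]
    by (simp add: norm_power p_def q_def del: csqrt.sel power2_csqrt)
  have "2 * p * \<bar>q\<bar> \<le> p\<^sup>2 - \<bar>q\<bar>\<^sup>2"
    using assms p0 unfolding re im by (simp add: abs_mult)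
  then have "2 * \<bar>q\<bar> \<le> p"
  proof (cases "p = 0")
    case False
    have "p * (2 * \<bar>q\<bar>) \<le> p * p"
      using \<open>2 * p * \<bar>q\<bar> \<le> _\<close> zero_le_power2[of "\<bar>q\<bar>"]
      unfolding power2_eq_square[of p] mult.left_commute[of p 2] mult.assoc by linarith
    then show ?thesis using False p0 by simp
  qed simp
  then have q2: "4 * q\<^sup>2 \<le> p\<^sup>2"
    using power_mono[of "2 * \<bar>q\<bar>" p 2] by (simp add: power_mult_distrib)
  have ps: "norm v / 4 \<le> p\<^sup>2" using q2 nrm zero_le_power2[of p] by linarith
  have ps': "sqrt (norm v) / 2 \<le> p"
    using real_sqrt_le_mono[OF ps] p0 by (simp add: real_sqrt_divide)
  have half: "norm v / 2 \<le> p\<^sup>2" using q2 nrm zero_le_power2[of q] by linarith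
  have "norm v * sqrt (norm v) / 16 = ((norm v / 2) * (sqrt (norm v) / 2)) / 4" by simp
  also have "\<dots> \<le> (p\<^sup>2 * p) / 4"
    by (intro divide_right_mono mult_mono half ps') auto
  also have "\<dots> \<le> p\<^sup>2 * p - 3 * (p * q\<^sup>2)"
    using mult_left_mono[OF q2 p0] by (simp add: mult.commute)
  also have "\<dots> = Re (csqrt v ^ 3)"
    unfolding p_def q_def by (simp add: power3_eq_cube power2_eq_square algebra_simps del: csqrt.sel)
  finally show ?thesis .
qed

text \<open>
  The function is damped by \<open>exp (- e * csqrt (u + 1) ^ 3)\<close>, which is at most \<open>1\<close> in modulus on
  the sector and beats the growth of \<open>F\<close> on large arcs. The maximum principle on a truncated
  sector bounds the damped function, and then \<open>e\<close> tends to \<open>0\<close>.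
\<close>

lemma phragmen_lindelof_sector:
  assumes hol: "F holomorphic_on UNIV"
    and growth: "\<And>u. norm (F u) \<le> C * exp (A * norm u)"
    and boundary: "\<And>u. \<bar>Im u\<bar> = Re u \<Longrightarrow> norm (F u) \<le> M"
    and "M > 0" and u0: "\<bar>Im u\<^sub>0\<bar> \<le> Re u\<^sub>0"
  shows "norm (F u\<^sub>0) \<le> M"
proof -
  \<comment> \<open>The shift by \<open>1\<close> keeps the branch point of the square root off the closed sector.\<close>
  define K where "K = (\<lambda>u. Re (csqrt (u + 1) ^ 3))"
  have "C \<ge> 0" using order_trans[OF norm_ge_zero growth[of 0]] by simp
  have K_lower: "norm u * sqrt (norm u) / 16 \<le> K u" if "\<bar>Im u\<bar> \<le> Re u" for u
  proof -
    have "Re u * Re u \<le> (1 + Re u) * (1 + Re u)"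
      using that by (intro mult_mono) auto
    then have "norm u \<le> norm (u + 1)"
      by (simp add: cmod_def power2_eq_square add.commute)
    then have "norm u * sqrt (norm u) / 16 \<le> norm (u + 1) * sqrt (norm (u + 1)) / 16"
      by (intro divide_right_mono mult_mono) auto
    also have "\<dots> \<le> K u" unfolding K_def
      using that by (intro Re_csqrt_cube_lower_bound) auto
    finally show ?thesis .
  qed
  have K_nonneg: "K u \<ge> 0" if "\<bar>Im u\<bar> \<le> Re u" for u
    using K_lower[OF that] by (rule order_trans[rotated]) auto
  have damped: "norm (F u\<^sub>0) \<le> M * exp (e * K u\<^sub>0)" if "e > 0" for e
  proof -
    define H where "H = (\<lambda>u. F u * exp (- (of_real e * csqrt (u + 1) ^ 3)))"
    have norm_H: "norm (H u) = norm (F u) * exp (- e * K u)" for u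
      by (simp add: H_def K_def norm_mult)
    \<comment> \<open>On the arc of radius \<open>R\<close> the damping exponent is at least \<open>(A + 1) * R\<close>, leaving at most
        \<open>C * exp (- R)\<close>, which is at most \<open>M\<close> because \<open>C \<le> M * R\<close>.\<close>
    define R where "R = norm u\<^sub>0 + (16 * (A + 1) / e)\<^sup>2 + C / M + 1"
    define S where "S = {u. \<bar>Im u\<bar> \<le> Re u \<and> norm u \<le> R}"
    have far: "norm (H u) \<le> M" if u: "\<bar>Im u\<bar> \<le> Re u" "norm u = R" for u
    proof -
      have "C / M \<ge> 0" using \<open>C \<ge> 0\<close> \<open>M > 0\<close> by simp
      then have "(16 * (A + 1) / e)\<^sup>2 \<le> R" "C / M \<le> R" "R > 0" 
        unfolding R_def by (smt (verit) norm_ge_zero zero_le_power2)+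
      then have "16 * (A + 1) / e \<le> sqrt R"
        using real_le_rsqrt by blast
      then have "A + 1 \<le> e * sqrt R / 16" using \<open>e > 0\<close> by (simp add: field_simps)
      then have "R * (A + 1) \<le> R * (e * sqrt R / 16)"
        using \<open>R > 0\<close> by (intro mult_left_mono) auto
      moreover have "e * (R * sqrt R / 16) \<le> e * K u"
        using K_lower[OF u(1)] u(2) \<open>e > 0\<close> by (intro mult_left_mono) auto
      ultimately have "A * R - e * K u \<le> - R" by (simp add: algebra_simps)
      then have "exp (A * R - e * K u) \<le> exp (- R)" by simp
      have "norm (H u) \<le> C * exp (A * R) * exp (- e * K u)"
        unfolding norm_H using growth[of u] u(2) by (intro mult_right_mono) auto
      also have "\<dots> = C * exp (A * R - e * K u)"
        by (simp add: exp_add[symmetric])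
      also have "\<dots> \<le> C * exp (- R)"
        using \<open>C \<ge> 0\<close> \<open>exp _ \<le> exp (- R)\<close> by (rule mult_left_mono[rotated])
      also have "\<dots> \<le> (M * R) * exp (- R)"
        using \<open>C / M \<le> R\<close> \<open>M > 0\<close> by (intro mult_right_mono) (auto simp: field_simps)
      also have "\<dots> \<le> (M * exp R) * exp (- R)"
        using exp_gt_self[of R] \<open>M > 0\<close> by (intro mult_right_mono mult_left_mono) auto
      also have "\<dots> = M" by (simp add: exp_minus)
      finally show ?thesis .
    qed
    have side: "norm (H u) \<le> M" if u: "\<bar>Im u\<bar> = Re u" for u
    proof -
      have "norm (H u) \<le> norm (F u) * 1"
        unfolding norm_H using K_nonneg[of u] u \<open>e > 0\<close> by (intro mult_left_mono) auto
      then show ?thesis using boundary[OF u] by simp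
    qed
    have "closed S"
      unfolding S_def by (intro closed_Collect_conj closed_Collect_le continuous_intros)
    have "{u. \<bar>Im u\<bar> < Re u \<and> norm u < R} \<subseteq> interior S"
      by (rule interior_maximal)
        (auto simp: S_def intro!: open_Collect_conj open_Collect_less continuous_intros)
    then have "frontier S \<subseteq> S - {u. \<bar>Im u\<bar> < Re u \<and> norm u < R}"
      using frontier_subset_closed[OF \<open>closed S\<close>] unfolding frontier_def by blast
    also have "\<dots> \<subseteq> {u. \<bar>Im u\<bar> \<le> Re u \<and> norm u = R} \<union> {u. \<bar>Im u\<bar> = Re u}"
      by (auto simp: S_def)
    finally have bound: "norm (H u) \<le> M" if "u \<in> frontier S" for u
      using that far[of u] side[of u] by blast
    have "H holomorphic_on {u. Re u > -1}"
      unfolding H_def using holomorphic_on_subset[OF hol]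
      by (intro holomorphic_intros) (auto simp: complex_nonpos_Reals_iff)
    moreover have "S \<subseteq> {u. Re u > -1}" by (auto simp: S_def)
    ultimately have holS: "H holomorphic_on S" using holomorphic_on_subset by blast
    have "norm (H u\<^sub>0) \<le> M"
    proof (rule maximum_modulus_frontier[OF _ _ _ bound])
      show "H holomorphic_on interior S"
        using holS holomorphic_on_subset interior_subset by blast
      show "continuous_on (closure S) H"
        using holS \<open>closed S\<close> by (simp add: holomorphic_on_imp_continuous_on)
      show "bounded S" by (rule boundedI[of _ R]) (auto simp: S_def)
      have "norm u\<^sub>0 \<le> R" using \<open>C \<ge> 0\<close> \<open>M > 0\<close> by (simp add: R_def)
      then show "u\<^sub>0 \<in> S" using u0 by (simp add: S_def)
    qed
    then show ?thesis by (simp add: norm_H exp_minus field_simps)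
  qed
  have "((\<lambda>e. M * exp (e * K u\<^sub>0)) \<longlongrightarrow> M * exp (0 * K u\<^sub>0)) (at_right 0)"
    by (intro tendsto_intros)
  moreover have "eventually (\<lambda>e. norm (F u\<^sub>0) \<le> M * exp (e * K u\<^sub>0)) (at_right 0)"
    using eventually_at_right_less[of 0] by eventually_elim (rule damped)
  ultimately have "norm (F u\<^sub>0) \<le> M * exp (0 * K u\<^sub>0)"
    by (rule tendsto_lowerbound) simp
  then show ?thesis by simp
qed

lemma holomorphic_on_scaled_argument:
  assumes "F holomorphic_on UNIV"
  shows "(\<lambda>z. F (a * z)) holomorphic_on UNIV"
proof -
  have "(F \<circ> (\<lambda>z. a * z)) holomorphic_on UNIV"
    by (intro holomorphic_on_compose holomorphic_intros holomorphic_on_subset[OF assms]) auto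
  then show ?thesis by (simp add: o_def)
qed

text \<open>
  Multiplication by \<open>1 + \<i>\<close> turns the sector around the positive axis into the first quadrant.
\<close>

lemma phragmen_lindelof_quadrant:
  assumes hol: "F holomorphic_on UNIV"
    and growth: "\<And>z. norm (F z) \<le> C * exp (A * norm z)"
    and real: "\<And>t. t \<ge> 0 \<Longrightarrow> norm (F (of_real t)) \<le> M"
    and imag: "\<And>t. t \<ge> 0 \<Longrightarrow> norm (F (\<i> * of_real t)) \<le> M"
    and "M > 0" "Re z \<ge> 0" "Im z \<ge> 0"
  shows "norm (F z) \<le> M"
proof -
  have "norm (F ((1 + \<i>) * (z * (1 - \<i>) / 2))) \<le> M"
  proof (rule phragmen_lindelof_sector[where F = "\<lambda>u. F ((1 + \<i>) * u)" and A = "A * sqrt 2"])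
    show "(\<lambda>u. F ((1 + \<i>) * u)) holomorphic_on UNIV"
      using hol by (rule holomorphic_on_scaled_argument)
    show "norm (F ((1 + \<i>) * u)) \<le> C * exp (A * sqrt 2 * norm u)" for u
      using growth[of "(1 + \<i>) * u"] by (simp add: norm_mult cmod_def[of "1 + \<i>"] mult.assoc)
    show "norm (F ((1 + \<i>) * u)) \<le> M" if "\<bar>Im u\<bar> = Re u" for u
    proof (cases "Im u \<ge> 0")
      case True
      then have "(1 + \<i>) * u = \<i> * of_real (2 * Im u)"
        using that by (simp add: complex_eq_iff)
      then show ?thesis using imag[of "2 * Im u"] True by simp
    next
      case False
      then have "(1 + \<i>) * u = of_real (2 * Re u)"
        using that by (simp add: complex_eq_iff)
      then show ?thesis using real[of "2 * Re u"] that by simp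
    qed
  qed (use assms in auto)
  also have "(1 + \<i>) * (z * (1 - \<i>) / 2) = z"
    by (simp add: complex_eq_iff)
  finally show ?thesis .
qed

text \<open>
  The factor \<open>exp (\<i> * \<beta> * z)\<close> has modulus \<open>1\<close> on the real line and cancels the growth of \<open>G\<close>
  along the positive imaginary axis, where the product is at most \<open>C \<le> M\<close>. Both quadrants of the
  half plane then have boundary values bounded by \<open>M\<close>.
\<close>

lemma phragmen_lindelof_upper_half_plane:
  assumes hol: "G holomorphic_on UNIV"
    and growth: "\<And>z. norm (G z) \<le> C * exp (\<beta> * norm z)"
    and real: "\<And>t. norm (G (of_real t)) \<le> M"
    and "\<beta> \<ge> 0" "C \<le> M" "M > 0" "Im z \<ge> 0"
  shows "norm (G z) \<le> M * exp (\<beta> * Im z)"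
proof -
  define F where "F = (\<lambda>z. G z * exp (\<i> * of_real \<beta> * z))"
  have norm_F: "norm (F z) = norm (G z) * exp (- \<beta> * Im z)" for z
    by (simp add: F_def norm_mult)
  have "C \<ge> 0" using order_trans[OF norm_ge_zero growth[of 0]] by simp
  have holF: "F holomorphic_on UNIV"
    unfolding F_def by (intro holomorphic_intros hol)
  have growthF: "norm (F z) \<le> C * exp ((2 * \<beta>) * norm z)" for z
  proof -
    have "- \<beta> * Im z \<le> \<beta> * norm z"
      using mult_left_mono[OF abs_Im_le_cmod[of z] \<open>\<beta> \<ge> 0\<close>]
        mult_left_mono[OF abs_ge_minus_self[of "Im z"] \<open>\<beta> \<ge> 0\<close>] by simp
    then have "norm (F z) \<le> (C * exp (\<beta> * norm z)) * exp (\<beta> * norm z)"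
      unfolding norm_F using growth[of z] \<open>C \<ge> 0\<close> by (intro mult_mono) auto
    then show ?thesis by (simp add: mult.assoc flip: exp_add)
  qed
  have realF: "norm (F (of_real t)) \<le> M" for t
    using real[of t] by (simp add: norm_F)
  have imagF: "norm (F (\<i> * of_real t)) \<le> M" if "t \<ge> 0" for t
  proof -
    have "norm (F (\<i> * of_real t)) \<le> C * exp (\<beta> * t) * exp (- \<beta> * t)"
      unfolding norm_F using growth[of "\<i> * of_real t"] that
      by (auto simp: norm_mult intro!: mult_right_mono)
    then show ?thesis using \<open>C \<le> M\<close> by (simp add: mult.assoc flip: exp_add)
  qed
  have "norm (F z) \<le> M"
  proof (cases "Re z \<ge> 0")
    case True
    show ?thesis
      by (rule phragmen_lindelof_quadrant[OF holF growthF realF imagF]) (use True assms in auto)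
  next
    case False
    have "norm (F (\<i> * (- \<i> * z))) \<le> M"
    proof (rule phragmen_lindelof_quadrant[where F = "\<lambda>z. F (\<i> * z)"])
      show "(\<lambda>z. F (\<i> * z)) holomorphic_on UNIV"
        using holF by (rule holomorphic_on_scaled_argument)
      show "norm (F (\<i> * u)) \<le> C * exp ((2 * \<beta>) * norm u)" for u
        using growthF[of "\<i> * u"] by (simp add: norm_mult)
      show "norm (F (\<i> * (\<i> * of_real t))) \<le> M" for t
        using realF[of "- t"] by (simp add: mult.assoc[symmetric])
    qed (use False assms imagF in auto)
    then show ?thesis by (simp add: mult.assoc[symmetric])
  qed
  then show ?thesis by (simp add: norm_F exp_minus field_simps)
qed

lemma phragmen_lindelof_exponential_type:
  assumes hol: "G holomorphic_on UNIV"
    and growth: "\<And>z. norm (G z) \<le> C * exp (\<beta> * norm z)"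
    and real: "\<And>t. norm (G (of_real t)) \<le> M"
    and "\<beta> \<ge> 0" "C \<le> M" "M > 0"
  shows "norm (G z) \<le> M * exp (\<beta> * \<bar>Im z\<bar>)"
proof (cases "Im z \<ge> 0")
  case True
  then show ?thesis
    using phragmen_lindelof_upper_half_plane[OF hol growth real] assms by simp
next
  case False
  have "norm (G (- (- z))) \<le> M * exp (\<beta> * Im (- z))"
  proof (rule phragmen_lindelof_upper_half_plane[where G = "\<lambda>z. G (- z)"])
    show "(\<lambda>z. G (- z)) holomorphic_on UNIV"
      using holomorphic_on_scaled_argument[OF hol, of "- 1"] by simp
    show "norm (G (- u)) \<le> C * exp (\<beta> * norm u)" for u
      using growth[of "- u"] by simp
    show "norm (G (- of_real t)) \<le> M" for t
      using real[of "- t"] by simp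
  qed (use False assms in auto)
  then show ?thesis using False by simp
qed

lemma norm_deriv_le_exponential_type:
  assumes "G holomorphic_on UNIV"
    and "\<And>z. norm (G z) \<le> C * exp (\<beta> * norm z)"
    and "\<And>t. norm (G (of_real t)) \<le> M"
    and "\<beta> \<ge> 0" "C \<le> M" "M > 0"
  shows "norm (deriv G (of_real x)) \<le> M * exp \<beta>"
proof -
  have "norm ((deriv ^^ 1) G (of_real x)) \<le> fact 1 * (M * exp \<beta>) / 1 ^ 1"
  proof (rule Cauchy_inequality)
    show "norm (G z) \<le> M * exp \<beta>" if "norm (of_real x - z) = 1" for z
    proof -
      have "\<bar>Im z\<bar> \<le> 1" using abs_Im_le_cmod[of "of_real x - z"] that by simp
      then have "\<beta> * \<bar>Im z\<bar> \<le> \<beta> * 1" using \<open>\<beta> \<ge> 0\<close> by (rule mult_left_mono)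
      then have "M * exp (\<beta> * \<bar>Im z\<bar>) \<le> M * exp \<beta>" using \<open>M > 0\<close> by simp
      then show ?thesis
        using phragmen_lindelof_exponential_type[OF assms, of z] by linarith
    qed
  qed (use assms(1) in \<open>auto intro: holomorphic_on_subset holomorphic_on_imp_continuous_on\<close>)
  then show ?thesis by simp
qed
section \<open>From local integrals to pointwise bounds\<close>

text \<open>
  The weighted average of \<open>g\<close> is an entire function of the same exponential type that is bounded on
  the real line by the local \<open>L\<^sup>1\<close> norm of \<open>g\<close>, so its derivative is bounded there as well. The
  bound is uniform in \<open>w\<close>. The condition \<open>C * exp \<beta> \<le> K\<close> covers the growth constant of
  the average, which shifts the argument of \<open>g\<close> by up to \<open>1\<close>.
\<close>

lemma norm_integral_weighted_deriv_le:
  fixes g :: "complex \<Rightarrow> complex" and w :: "real \<Rightarrow> complex"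
  assumes hol: "g holomorphic_on UNIV"
    and growth: "\<And>z. norm (g z) \<le> C * exp (\<beta> * norm z)"
    and L1: "\<And>x. integral {0..1} (\<lambda>t. norm (g (of_real (x + t)))) \<le> M"
    and "\<beta> \<ge> 0" and K: "K > 0" "M \<le> K" "C * exp \<beta> \<le> K"
    and w: "continuous_on {0..1} w" "\<And>t. t \<in> {0..1} \<Longrightarrow> norm (w t) \<le> 1"
  shows "norm (integral {0..1} (\<lambda>t. w t * deriv g (of_real (x + t)))) \<le> K * exp \<beta>"
proof -
  define G where "G = (\<lambda>z. integral {0..1} (\<lambda>t. w t * g (z + of_real t)))"
  have "C \<ge> 0" using order_trans[OF norm_ge_zero growth[of 0]] by simp
  have contg: "continuous_on UNIV g"
    using hol by (rule holomorphic_on_imp_continuous_on)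
  have contg': "continuous_on UNIV (deriv g)"
    using hol by (intro holomorphic_on_imp_continuous_on holomorphic_deriv) auto
  have cont_wg: "continuous_on {0..1} (\<lambda>t. w t * g (z + of_real t))" for z
    by (intro continuous_intros w continuous_on_compose2[OF contg]) auto
  have dG: "(G has_field_derivative integral {0..1} (\<lambda>t. w t * deriv g (z + of_real t))) (at z)" for z
  proof -
    have "((\<lambda>z. integral (cbox 0 1) (\<lambda>t. w t * g (z + of_real t))) has_field_derivative
        integral (cbox 0 1) (\<lambda>t. w t * deriv g (z + of_real t))) (at z within UNIV)"
    proof (rule leibniz_rule_field_derivative)
      show "((\<lambda>z. w t * g (z + of_real t)) has_field_derivative w t * deriv g (z + of_real t))
          (at z within UNIV)" for z t
      proof -
        have "(g has_field_derivative deriv g (z + of_real t)) (at (z + of_real t))"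
          using hol by (rule holomorphic_derivI) auto
        then have "((\<lambda>z. g (z + of_real t)) has_field_derivative deriv g (z + of_real t)) (at z)"
          by (simp add: DERIV_shift)
        then show ?thesis by (rule DERIV_cmult)
      qed
      show "(\<lambda>t. w t * g (z + of_real t)) integrable_on cbox 0 1" for z
        using cont_wg[of z] by (simp add: integrable_continuous_real)
      show "continuous_on (UNIV \<times> cbox 0 1) (\<lambda>(z, t). w t * deriv g (z + of_real t))"
        unfolding split_beta
        by (intro continuous_intros continuous_on_compose2[OF contg'] continuous_on_compose2[OF w(1)]) auto
    qed auto
    then show ?thesis by (simp add: G_def)
  qed
  have holG: "G holomorphic_on UNIV"
    using dG by (auto simp: holomorphic_on_open)
  have growthG: "norm (G z) \<le> (C * exp \<beta>) * exp (\<beta> * norm z)" for z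
  proof -
    have "norm (G z) \<le> (C * exp \<beta>) * exp (\<beta> * norm z) * (1 - 0)"
      unfolding G_def
    proof (rule integral_bound[OF _ cont_wg])
      fix t :: real assume t: "t \<in> {0..1}"
      have "norm (z + of_real t) \<le> norm z + 1"
        using norm_triangle_ineq[of z "of_real t"] t by auto
      then have "\<beta> * norm (z + of_real t) \<le> \<beta> * (norm z + 1)"
        using \<open>\<beta> \<ge> 0\<close> by (rule mult_left_mono)
      then have "C * exp (\<beta> * norm (z + of_real t)) \<le> C * exp (\<beta> * (norm z + 1))"
        using \<open>C \<ge> 0\<close> by (intro mult_left_mono) auto
      then have "norm (g (z + of_real t)) \<le> C * exp (\<beta> * (norm z + 1))"
        using growth[of "z + of_real t"] by linarith
      then have "norm (w t) * norm (g (z + of_real t)) \<le> 1 * (C * exp (\<beta> * (norm z + 1)))"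
        using w(2)[OF t] by (intro mult_mono) auto
      also have "1 * (C * exp (\<beta> * (norm z + 1))) = (C * exp \<beta>) * exp (\<beta> * norm z)"
        by (simp add: algebra_simps exp_add)
      finally show "norm (w t * g (z + of_real t)) \<le> (C * exp \<beta>) * exp (\<beta> * norm z)"
        by (simp add: norm_mult)
    qed simp
    then show ?thesis by simp
  qed
  have realG: "norm (G (of_real y)) \<le> K" for y
  proof -
    have "norm (G (of_real y)) \<le> integral {0..1} (\<lambda>t. norm (g (of_real (y + t))))"
      unfolding G_def
    proof (rule integral_norm_bound_integral)
      show "(\<lambda>t. w t * g (of_real y + of_real t)) integrable_on {0..1}"
        by (intro integrable_continuous_real cont_wg)
      show "(\<lambda>t. norm (g (of_real (y + t)))) integrable_on {0..1}"
        by (intro integrable_continuous_real continuous_intros continuous_on_compose2[OF contg]) auto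
      show "norm (w t * g (of_real y + of_real t)) \<le> norm (g (of_real (y + t)))"
        if "t \<in> {0..1}" for t
        using mult_right_mono[OF w(2)[OF that] norm_ge_zero[of "g (of_real (y + t))"]]
        by (simp add: norm_mult)
    qed
    then show ?thesis using L1[of y] K by linarith
  qed
  have "norm (deriv G (of_real x)) \<le> K * exp \<beta>"
    by (rule norm_deriv_le_exponential_type[OF holG growthG realG]) (use assms in auto)
  then show ?thesis
    using DERIV_imp_deriv[OF dG, of "of_real x"] by simp
qed

text \<open>
  The dual weight \<open>cnj g' / \<bar>g'\<bar>\<close> would give equality but is discontinuous at the zeros of
  \<open>g'\<close>. Adding \<open>e\<close> to the denominator makes it continuous at the cost of at most \<open>e\<close>.
\<close>

lemma integral_norm_deriv_le:
  fixes g :: "complex \<Rightarrow> complex"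
  assumes hol: "g holomorphic_on UNIV"
    and growth: "\<And>z. norm (g z) \<le> C * exp (\<beta> * norm z)"
    and L1: "\<And>x. integral {0..1} (\<lambda>t. norm (g (of_real (x + t)))) \<le> M"
    and "\<beta> \<ge> 0" and K: "K > 0" "M \<le> K" "C * exp \<beta> \<le> K"
  shows "integral {0..1} (\<lambda>t. norm (deriv g (of_real (x + t)))) \<le> K * exp \<beta>"
proof (rule field_le_epsilon)
  fix e :: real assume "e > 0"
  define h where "h = (\<lambda>t. deriv g (of_real (x + t)))"
  define w where "w = (\<lambda>t. cnj (h t) / of_real (norm (h t) + e))"
  have "continuous_on UNIV (deriv g)"
    using hol by (intro holomorphic_on_imp_continuous_on holomorphic_deriv) auto
  then have conth: "continuous_on {0..1} h"
    unfolding h_def by (rule continuous_on_compose2) (auto intro!: continuous_intros)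
  have pos: "norm (h t) + e > 0" for t
    using \<open>e > 0\<close> norm_ge_zero[of "h t"] by linarith
  then have nz: "complex_of_real (norm (h t) + e) \<noteq> 0" for t
    by (metis less_irrefl of_real_eq_0_iff)
  have contw: "continuous_on {0..1} w"
    unfolding w_def by (intro continuous_intros conth ballI nz)
  have normw: "norm (w t) \<le> 1" for t
    using pos[of t] \<open>e > 0\<close> by (simp add: w_def norm_divide del: of_real_add)
  have wh: "w t * h t = of_real ((norm (h t))\<^sup>2 / (norm (h t) + e))" for t
    unfolding w_def of_real_divide complex_norm_square[of "h t"] by (simp del: of_real_add)
  have "norm (h t) - e \<le> (norm (h t))\<^sup>2 / (norm (h t) + e)" for t
    unfolding pos_le_divide_eq[OF pos] by (simp add: power2_eq_square algebra_simps)
  then have "norm (h t) - e \<le> Re (w t * h t)" for t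
    unfolding wh by simp
  then have "integral {0..1} (\<lambda>t. norm (h t) - e) \<le> integral {0..1} (\<lambda>t. Re (w t * h t))"
    by (intro integral_le integrable_continuous_real continuous_intros conth contw) auto
  also have "\<dots> = Re (integral {0..1} (\<lambda>t. w t * h t))"
    using integral_linear[OF integrable_continuous_real bounded_linear_Re, of 0 1 "\<lambda>t. w t * h t"]
    by (simp add: o_def continuous_on_mult contw conth)
  also have "\<dots> \<le> norm (integral {0..1} (\<lambda>t. w t * h t))" by (rule complex_Re_le_cmod)
  also have "\<dots> \<le> K * exp \<beta>"
    unfolding h_def
    by (rule norm_integral_weighted_deriv_le[OF assms contw normw])
  finally have "integral {0..1} (\<lambda>t. norm (h t) - e) \<le> K * exp \<beta>" .
  moreover have "integral {0..1} (\<lambda>t. norm (h t) - e) = integral {0..1} (\<lambda>t. norm (h t)) - e"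
    by (subst integral_diff) (auto intro!: integrable_continuous_real continuous_intros conth)
  ultimately show "integral {0..1} (\<lambda>t. norm (deriv g (of_real (x + t)))) \<le> K * exp \<beta> + e"
    by (simp add: h_def)
qed

text \<open>
  The value at \<open>x\<close> differs from the value at \<open>x + t\<close> by at most the integral of \<open>\<bar>g'\<bar>\<close>
  over a unit interval. Averaging over \<open>t\<close> replaces the latter value by an integral.
\<close>

lemma exponential_type_bounded_of_local_L1:
  fixes g :: "complex \<Rightarrow> complex"
  assumes hol: "g holomorphic_on UNIV"
    and growth: "\<And>z. norm (g z) \<le> C * exp (\<beta> * norm z)"
    and L1: "\<And>x. integral {0..1} (\<lambda>t. norm (g (of_real (x + t)))) \<le> M"
    and "\<beta> \<ge> 0" and K: "K > 0" "M \<le> K" "C * exp \<beta> \<le> K"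
  shows "norm (g (of_real x)) \<le> K + K * exp \<beta>"
proof -
  have contg: "continuous_on UNIV g"
    using hol by (rule holomorphic_on_imp_continuous_on)
  have contg': "continuous_on UNIV (deriv g)"
    using hol by (intro holomorphic_on_imp_continuous_on holomorphic_deriv) auto
  have int': "(\<lambda>t. norm (deriv g (of_real (x + t)))) integrable_on {a..b}" for a b
    by (intro integrable_continuous_real continuous_intros continuous_on_compose2[OF contg']) auto
  have le: "norm (g (of_real x)) \<le> norm (g (of_real (x + t))) + K * exp \<beta>"
    if t: "t \<in> {0..1}" for t
  proof -
    have ftc: "((\<lambda>s. deriv g (of_real (x + s))) has_integral
        g (of_real (x + t)) - g (of_real (x + 0))) {0..t}"
    proof (rule fundamental_theorem_of_calculus)
      fix s
      have "(g has_field_derivative deriv g (of_real (x + s))) (at (of_real (x + s)))"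
        using hol by (rule holomorphic_derivI) auto
      moreover have "((\<lambda>s. of_real (x + s)) has_vector_derivative of_real 1) (at s within {0..t})"
        by (auto intro!: derivative_eq_intros has_vector_derivative_real_field)
      ultimately show "((\<lambda>s. g (of_real (x + s))) has_vector_derivative deriv g (of_real (x + s)))
          (at s within {0..t})"
        using field_vector_diff_chain_within[of "\<lambda>s. of_real (x + s)" 1 s "{0..t}" g "deriv g (of_real (x + s))"]
        by (auto simp: o_def intro: has_field_derivative_at_within)
    qed (use t in auto)
    have "norm (g (of_real x)) \<le> norm (g (of_real (x + t))) + norm (g (of_real (x + t)) - g (of_real (x + 0)))"
      using norm_triangle_sub[of "g (of_real x)" "g (of_real (x + t))"] by (simp add: norm_minus_commute)
    also have "norm (g (of_real (x + t)) - g (of_real (x + 0)))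
        = norm (integral {0..t} (\<lambda>s. deriv g (of_real (x + s))))"
      using integral_unique[OF ftc] by simp
    also have "\<dots> \<le> integral {0..t} (\<lambda>s. norm (deriv g (of_real (x + s))))"
      using ftc int' by (intro integral_norm_bound_integral) auto
    also have "\<dots> \<le> integral {0..1} (\<lambda>s. norm (deriv g (of_real (x + s))))"
      using t int' by (intro integral_subset_le) auto
    also have "\<dots> \<le> K * exp \<beta>" by (rule integral_norm_deriv_le[OF assms])
    finally show ?thesis by simp
  qed
  have "norm (g (of_real x)) = integral {0..1::real} (\<lambda>t. norm (g (of_real x)))" by simp
  also have "\<dots> \<le> integral {0..1} (\<lambda>t. norm (g (of_real (x + t))) + K * exp \<beta>)"
    using le by (intro integral_le integrable_continuous_real continuous_intros
        continuous_on_compose2[OF contg]) auto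
  also have "\<dots> = integral {0..1} (\<lambda>t. norm (g (of_real (x + t)))) + K * exp \<beta>"
    by (subst integral_add)
      (auto intro!: integrable_continuous_real continuous_intros continuous_on_compose2[OF contg])
  finally show ?thesis using L1[of x] K by linarith
qed

section \<open>Increments of functions of bounded mean oscillation\<close>

lemma integral_deviation_le_bmo_norm:
  fixes \<phi> :: "real \<Rightarrow> complex"
  assumes cont: "continuous_on UNIV \<phi>" and fin: "bmo_norm \<phi> < \<infinity>" and "l > 0"
  obtains m where "integral {a..a + l} (\<lambda>t. norm (\<phi> t - m)) \<le> enn2real (bmo_norm \<phi>) * l"
proof
  define I where "I = {a..a + l}"
  define m where "m = (LBINT s:I. \<phi> s) /\<^sub>R measure lborel I"
  define J where "J = integral {a..a + l} (\<lambda>t. norm (\<phi> t - m))"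
  have eI: "emeasure lborel I = ennreal l" and mI: "measure lborel I = l"
    using \<open>l > 0\<close> by (simp_all add: I_def)
  have hasint: "((\<lambda>t. norm (\<phi> t - m)) has_integral J) {a..a + l}"
    unfolding J_def
    by (intro integrable_integral integrable_continuous_real continuous_intros
        continuous_on_subset[OF cont]) auto
  then have "J \<ge> 0" by (rule has_integral_nonneg) auto
  have "(\<integral>\<^sup>+ t\<in>I. ennreal (norm (\<phi> t - m)) \<partial>lborel) = ennreal J"
    unfolding I_def using hasint by (intro nn_integral_has_integral_lebesgue') auto
  then have "(\<integral>\<^sup>+ t\<in>I. ennreal (norm (\<phi> t - m)) \<partial>lborel) / emeasure lborel I = ennreal (J / l)"
    using \<open>l > 0\<close> \<open>J \<ge> 0\<close> by (simp add: eI divide_ennreal)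
  moreover have "(\<integral>\<^sup>+ t\<in>I. ennreal (norm (\<phi> t - m)) \<partial>lborel) / emeasure lborel I \<le> bmo_norm \<phi>"
    unfolding bmo_norm_def m_def
    using \<open>l > 0\<close> by (intro SUP_upper) (auto simp: I_def is_interval_cc)
  ultimately have "ennreal (J / l) \<le> ennreal (enn2real (bmo_norm \<phi>))"
    using fin by (simp add: ennreal_enn2real)
  then have "J / l \<le> enn2real (bmo_norm \<phi>)" by (simp add: ennreal_le_iff)
  then show "integral {a..a + l} (\<lambda>t. norm (\<phi> t - m)) \<le> enn2real (bmo_norm \<phi>) * l"
    using \<open>l > 0\<close> by (simp add: J_def field_simps)
qed

text \<open>
  Both \<open>\<phi> (x + t + h)\<close> and \<open>\<phi> (x + t)\<close> are compared with the mean value of \<open>\<phi>\<close> over one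
  interval \<open>[x, x + r + 1]\<close> that contains both translates of the unit interval.
\<close>

lemma integral_norm_increment_le_bmo_norm:
  fixes \<phi> :: "real \<Rightarrow> complex"
  assumes cont: "continuous_on UNIV \<phi>" and fin: "bmo_norm \<phi> < \<infinity>"
    and h: "0 \<le> h" "h \<le> r"
  shows "integral {0..1} (\<lambda>t. norm (\<phi> (x + t + h) - \<phi> (x + t)))
    \<le> 2 * (enn2real (bmo_norm \<phi>) * (r + 1))"
proof -
  obtain m where m: "integral {x..x + (r + 1)} (\<lambda>t. norm (\<phi> t - m))
      \<le> enn2real (bmo_norm \<phi>) * (r + 1)"
    using h by (rule_tac integral_deviation_le_bmo_norm[OF cont fin, of "r + 1" x]) auto
  define \<psi> where "\<psi> = (\<lambda>t. norm (\<phi> t - m))"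
  have cont\<psi>: "continuous_on S \<psi>" for S
    unfolding \<psi>_def by (intro continuous_intros continuous_on_subset[OF cont]) auto
  have int: "(\<lambda>t. \<psi> (t + c)) integrable_on {0..1}" for c
    by (intro integrable_continuous_real continuous_on_compose2[OF cont\<psi>[of UNIV]] continuous_intros) auto
  have part: "integral {0..1} (\<lambda>t. \<psi> (t + c)) \<le> enn2real (bmo_norm \<phi>) * (r + 1)"
    if "x \<le> c" "c \<le> x + r" for c
  proof -
    have "integral {0..1} (\<lambda>t. \<psi> (t + c)) = integral {c..c + 1} \<psi>"
      using integral_shift_real_ivl[of c c "c + 1" \<psi>] by simp
    also have "\<dots> \<le> integral {x..x + (r + 1)} \<psi>"
      using that by (intro integral_subset_le integrable_continuous_real cont\<psi>) (auto simp: \<psi>_def)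
    finally show ?thesis using m by (simp add: \<psi>_def)
  qed
  have "integral {0..1} (\<lambda>t. norm (\<phi> (x + t + h) - \<phi> (x + t)))
      \<le> integral {0..1} (\<lambda>t. \<psi> (t + (x + h)) + \<psi> (t + x))"
  proof (rule integral_le)
    show "(\<lambda>t. norm (\<phi> (x + t + h) - \<phi> (x + t))) integrable_on {0..1}"
      by (intro integrable_continuous_real continuous_intros continuous_on_compose2[OF cont]) auto
    show "norm (\<phi> (x + t + h) - \<phi> (x + t)) \<le> \<psi> (t + (x + h)) + \<psi> (t + x)" for t
      using norm_triangle_ineq4[of "\<phi> (x + t + h) - m" "\<phi> (x + t) - m"]
      by (simp add: \<psi>_def algebra_simps)
  qed (intro integrable_add int)
  also have "\<dots> = integral {0..1} (\<lambda>t. \<psi> (t + (x + h))) + integral {0..1} (\<lambda>t. \<psi> (t + x))"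
    by (intro integral_add int)
  finally show ?thesis using part[of "x + h"] part[of x] h by linarith
qed

text \<open>
  For fixed \<open>h\<close> the difference \<open>f (z + h) - f z\<close> is of exponential type with locally bounded
  integrals on the real line. All constants depend on \<open>h\<close> only through the bound \<open>r\<close>.
\<close>

lemma exponential_type_bmo_increments_bounded:
  fixes f :: "complex \<Rightarrow> complex"
  assumes hol: "f holomorphic_on UNIV"
    and growth: "\<And>z. norm (f z) \<le> C * exp (\<beta> * norm z)" and "\<beta> \<ge> 0"
    and fin: "bmo_norm (\<lambda>t. f (of_real t)) < \<infinity>"
  shows "\<exists>B. \<forall>x h. 0 \<le> h \<longrightarrow> h \<le> r \<longrightarrow> norm (f (of_real (x + h)) - f (of_real x)) \<le> B"
proof -
  define N where "N = enn2real (bmo_norm (\<lambda>t. f (of_real t)))"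
  define C' where "C' = C * (1 + exp (\<beta> * \<bar>r\<bar>))"
  define K where "K = 2 * (N * (\<bar>r\<bar> + 1)) + C' * exp \<beta> + 1"
  have "C \<ge> 0" using order_trans[OF norm_ge_zero growth[of 0]] by simp
  then have "C' \<ge> 0" by (simp add: C'_def)
  have "N \<ge> 0" by (simp add: N_def)
  then have "N * (\<bar>r\<bar> + 1) \<ge> 0" by simp
  moreover have "C' * exp \<beta> \<ge> 0" using \<open>C' \<ge> 0\<close> by simp
  ultimately have K: "K > 0" "2 * (N * (\<bar>r\<bar> + 1)) \<le> K" "C' * exp \<beta> \<le> K"
    unfolding K_def by linarith+
  have contf: "continuous_on UNIV f"
    using hol by (rule holomorphic_on_imp_continuous_on)
  then have cont: "continuous_on UNIV (\<lambda>t. f (complex_of_real t))"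
    by (rule continuous_on_compose2) (auto intro!: continuous_intros)
  have "norm (f (of_real (x + h)) - f (of_real x)) \<le> K + K * exp \<beta>" if h: "0 \<le> h" "h \<le> r" for x h
  proof -
    define g where "g = (\<lambda>z. f (z + of_real h) - f z)"
    have "norm (g (of_real x)) \<le> K + K * exp \<beta>"
    proof (rule exponential_type_bounded_of_local_L1[OF _ _ _ \<open>\<beta> \<ge> 0\<close> K])
      have "f holomorphic_on S" for S
        using holomorphic_on_subset[OF hol] by blast
      then have "(f \<circ> (\<lambda>z. z + of_real h)) holomorphic_on UNIV"
        by (intro holomorphic_on_compose holomorphic_intros)
      then show "g holomorphic_on UNIV"
        unfolding g_def o_def by (intro holomorphic_intros hol)
      show "norm (g z) \<le> C' * exp (\<beta> * norm z)" for z
      proof -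
        have "norm (z + of_real h) \<le> norm z + \<bar>r\<bar>"
          using norm_triangle_ineq[of z "of_real h"] h by auto
        then have "\<beta> * norm (z + of_real h) \<le> \<beta> * (norm z + \<bar>r\<bar>)"
          using \<open>\<beta> \<ge> 0\<close> by (rule mult_left_mono)
        then have "C * exp (\<beta> * norm (z + of_real h)) \<le> C * exp (\<beta> * (norm z + \<bar>r\<bar>))"
          using \<open>C \<ge> 0\<close> by (intro mult_left_mono) auto
        then have "norm (g z) \<le> C * exp (\<beta> * (norm z + \<bar>r\<bar>)) + C * exp (\<beta> * norm z)"
          using norm_triangle_ineq4[of "f (z + of_real h)" "f z"] growth[of z] growth[of "z + of_real h"]
          unfolding g_def by linarith
        then show ?thesis by (simp add: C'_def algebra_simps exp_add)
      qed
      show "integral {0..1} (\<lambda>t. norm (g (of_real (y + t)))) \<le> 2 * (N * (\<bar>r\<bar> + 1))" for y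
        using integral_norm_increment_le_bmo_norm[OF cont fin, of h "\<bar>r\<bar>" y] h
        by (simp add: g_def N_def)
    qed
    then show ?thesis by (simp add: g_def)
  qed
  then show ?thesis by (intro exI[of _ "K + K * exp \<beta>"] allI impI)
qed

section \<open>Sampling on relatively dense sequences\<close>

text \<open>
  If gaps of every length occurred, the infimum over windows would vanish for every window length.
\<close>

lemma positive_lower_uniform_density_imp_relatively_dense:
  assumes "lower_uniform_density x > 0"
  shows "\<exists>r. \<forall>a. \<exists>k. x k \<in> {a..<a + r}"
proof (rule ccontr)
  assume no: "\<nexists>r. \<forall>a. \<exists>k. x k \<in> {a..<a + r}"
  have "(INF a::real. num_points x {a..<a + r} / ennreal r) \<le> 0" for r
  proof -
    obtain a where "{k. x k \<in> {a..<a + r}} = {}" using no by blast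
    then have "num_points x {a..<a + r} / ennreal r = 0"
      unfolding num_points_def by (metis emeasure_empty ennreal_zero_divide)
    then show ?thesis by (intro INF_lower2[of a]) auto
  qed
  then have "lower_uniform_density x \<le> 0"
    unfolding lower_uniform_density_def by (intro Limsup_bounded always_eventually) blast
  then show False using assms by simp
qed

lemma exponential_growth_of_exp_type_finite:
  assumes "exp_type f \<le> ereal \<sigma>"
  shows "f holomorphic_on UNIV \<and> (\<exists>C \<beta>. \<beta> \<ge> 0 \<and> (\<forall>z. norm (f z) \<le> C * exp (\<beta> * norm z)))"
proof -
  have hol: "f holomorphic_on UNIV"
    using assms by (auto simp: exp_type_def split: if_splits)
  have "exp_type f < \<infinity>"
    using assms by (rule order_le_less_trans) simp
  then obtain \<beta> C where bC: "\<And>z. norm (f z) \<le> C * exp (\<beta> * norm z)"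
    using hol unfolding exp_type_def if_P[OF hol] INF_less_iff by blast
  have "C \<ge> 0" using order_trans[OF norm_ge_zero bC[of 0]] by simp
  \<comment> \<open>An admissible exponent may be negative (for \<open>f = 0\<close>), hence the maximum with \<open>0\<close>.\<close>
  have "norm (f z) \<le> C * exp (max \<beta> 0 * norm z)" for z
  proof -
    have "C * exp (\<beta> * norm z) \<le> C * exp (max \<beta> 0 * norm z)"
      using \<open>C \<ge> 0\<close> by (intro mult_left_mono) (auto intro: mult_right_mono)
    then show ?thesis using bC[of z] by linarith
  qed
  then show ?thesis using hol by (intro conjI exI[of _ C] exI[of _ "max \<beta> 0"]) auto
qed

theorem corollary8:
  fixes b :: real and c :: complex and f :: "complex \<Rightarrow> complex"
  assumes "b > 0"
    and "f \<in> PW_star c b"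
  shows "f \<in> PW_infty b \<or>
    \<not> (\<exists>x :: int \<Rightarrow> real.
          separated_seq x \<and>
          lower_uniform_density x > 0 \<and>
          bounded (range (\<lambda>k. f (of_real (x k)))))"
proof (rule disjCI)
  assume "\<not> \<not> (\<exists>x :: int \<Rightarrow> real. separated_seq x \<and> lower_uniform_density x > 0 \<and>
      bounded (range (\<lambda>k. f (of_real (x k)))))"
  then obtain x :: "int \<Rightarrow> real" where dens: "lower_uniform_density x > 0"
    and "bounded (range (\<lambda>k. f (of_real (x k))))" by blast
  then obtain D where D: "norm (f (of_real (x k))) \<le> D" for k
    by (auto simp: bounded_iff)
  have type: "exp_type f \<le> ereal (pi * b)" and fin: "bmo_norm (\<lambda>t. f (of_real t)) < \<infinity>"
    using assms(2) unfolding PW_star_def by (simp_all add: less_top)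
  obtain \<beta> C where hol: "f holomorphic_on UNIV" and "\<beta> \<ge> 0"
    and growth: "\<And>z. norm (f z) \<le> C * exp (\<beta> * norm z)"
    using exponential_growth_of_exp_type_finite[OF type] by metis
  obtain r where r: "\<And>a. \<exists>k. x k \<in> {a..<a + r}"
    using positive_lower_uniform_density_imp_relatively_dense[OF dens] by blast
  obtain B where B: "\<And>y h. 0 \<le> h \<Longrightarrow> h \<le> r \<Longrightarrow> norm (f (of_real (y + h)) - f (of_real y)) \<le> B"
    using exponential_type_bmo_increments_bounded[OF hol growth \<open>\<beta> \<ge> 0\<close> fin, of r] by blast
  have bound: "norm (f (of_real t)) \<le> D + B" for t
  proof -
    obtain k where "x k \<in> {t - r..<t - r + r}" using r by blast
    then have "norm (f (of_real t) - f (of_real (x k))) \<le> B"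
      using B[of "t - x k" "x k"] by simp
    then show ?thesis
      using D[of k] norm_triangle_sub[of "f (of_real t)" "f (of_real (x k))"] by linarith
  qed
  have "continuous_on UNIV (\<lambda>t. f (complex_of_real t))"
    using holomorphic_on_imp_continuous_on[OF hol]
    by (rule continuous_on_compose2) (auto intro!: continuous_intros)
  then have "(\<lambda>t. f (complex_of_real t)) \<in> borel_measurable lebesgue"
    by (intro measurable_completion) (simp add: borel_measurable_continuous_onI)
  then have "in_Linfty (\<lambda>t. f (of_real t))"
    using bound by (auto simp: in_Linfty_def)
  then show "f \<in> PW_infty b" using type by (simp add: PW_infty_def)
qed

end
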